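(* Let $\rho = \rho_{AB}$ be a density operator on $\mathbb{C}^2\otimes\mathbb{C}^2$ (two qubits $A$ and $B$) that is locally maximally mixed, i.e. $\rho_A=\mathrm{Tr}_B(\rho)=\tfrac{1}{2}\mathbb{1}_2$ and $\rho_B=\mathrm{Tr}_A(\rho)=\tfrac{1}{2}\mathbb{1}_2$. Let $\rho_{A|B}$ be the Cerf–Adami conditional amplitude operator $$\rho_{A|B} = 2^{\,\log_2\rho_{AB} - \log_2(\mathbb{1}_A\otimes\rho_B)}.$$ Then $\rho_{A|B}\le \mathbb{1}$ (i.e. $\mathbb{1}-\rho_{A|B}$ is positive semidefinite) if and only if $\rho$ is separable; equivalently, $\rho_{A|B}\not\le\mathbb{1}$ if and only if $\rho$ is entangled.
   Context: A two-qubit state $\rho$ is separable if it can be written as a convex combination $\sum_n p_n\,\rho^A_n\otimes\rho^B_n$ of product states, and entangled otherwise. Logarithms and exponentials are to base $2$ and are taken via functional calculus of the Hermitian operators involved. The conditional amplitude operator is defined on the support of $\rho_{AB}$: if $\rho_{AB}$ has zero eigenvalues, these are handled by replacing each vanishing eigenvalue by $\epsilon>0$, computing the operator, and taking the limit $\epsilon\to 0$ (so zero eigenvalues of $\rho_{AB}$ give zero eigenvalues of $\rho_{A|B}$). Locally maximally mixed two-qubit states are equivalently those of the form $\rho=\tfrac14\bigl(\mathbb{1}\otimes\mathbb{1}+\sum_{m,n=1}^3 t_{mn}\,\sigma_m\otimes\sigma_n\bigr)$ with $\sigma_m$ the Pauli matrices and real $t_{mn}$. *)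

theory Defs
  imports "HOL-Analysis.Analysis"
begin

text \<open>Square complex matrices indexed by a finite type; two-qubit operators are
  indexed by the product type 2 \<times> 2 (first component: qubit A, second: qubit B).\<close>

definition cadj :: "complex^'n^'n \<Rightarrow> complex^'n^'n" where
  "cadj A = (\<chi> i j. cnj (A $ j $ i))"

definition hermitian :: "complex^'n^'n \<Rightarrow> bool" where
  "hermitian A \<longleftrightarrow> cadj A = A"

definition unitary :: "complex^'n^'n \<Rightarrow> bool" where
  "unitary U \<longleftrightarrow> cadj U ** U = mat 1"

definition cdiag :: "('n \<Rightarrow> complex) \<Rightarrow> complex^'n^'n" where
  "cdiag d = (\<chi> i j. if i = j then d i else 0)"

definition psd :: "complex^'n^'n \<Rightarrow> bool" where
  "psd A \<longleftrightarrow> hermitian A \<and>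
     (\<forall>x::complex^'n. Re (\<Sum>i\<in>UNIV. cnj (x $ i) * (A *v x) $ i) \<ge> 0)"

definition ctrace :: "complex^'n^'n \<Rightarrow> complex" where
  "ctrace A = (\<Sum>i\<in>UNIV. A $ i $ i)"

definition density :: "complex^'n^'n \<Rightarrow> bool" where
  "density A \<longleftrightarrow> psd A \<and> ctrace A = 1"

definition mat_fun :: "(real \<Rightarrow> real) \<Rightarrow> complex^'n^'n \<Rightarrow> complex^'n^'n" where
  "mat_fun f A = (THE B. \<exists>U d. unitary U \<and>
       A = U ** cdiag (\<lambda>i. complex_of_real (d i)) ** cadj U \<and>
       B = U ** cdiag (\<lambda>i. complex_of_real (f (d i))) ** cadj U)"

definition kron :: "complex^'a^'a \<Rightarrow> complex^'b^'b \<Rightarrow> complex^('a::finite\<times>'b::finite)^('a\<times>'b)" where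
  "kron A B = (\<chi> p q. A $ fst p $ fst q * B $ snd p $ snd q)"

definition ptrace_B :: "complex^('a::finite\<times>'b::finite)^('a\<times>'b) \<Rightarrow> complex^'a^'a" where
  "ptrace_B R = (\<chi> i k. \<Sum>j\<in>UNIV. R $ (i, j) $ (k, j))"

definition ptrace_A :: "complex^('a::finite\<times>'b::finite)^('a\<times>'b) \<Rightarrow> complex^'b^'b" where
  "ptrace_A R = (\<chi> j l. \<Sum>i\<in>UNIV. R $ (i, j) $ (i, l))"

definition separable :: "complex^('a::finite\<times>'b::finite)^('a\<times>'b) \<Rightarrow> bool" where
  "separable R \<longleftrightarrow> (\<exists>(n::nat) (p::nat \<Rightarrow> real) RA RB.
      (\<forall>k<n. p k \<ge> 0 \<and> density (RA k) \<and> density (RB k)) \<and>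
      (\<Sum>k<n. p k) = 1 \<and>
      R = (\<Sum>k<n. mat (complex_of_real (p k)) ** kron (RA k) (RB k)))"

definition regularise :: "real \<Rightarrow> complex^'n^'n \<Rightarrow> complex^'n^'n" where
  "regularise eps A = mat_fun (\<lambda>x. if x = 0 then eps else x) A"

text \<open>Cerf--Adami conditional amplitude operator
  rho_{A|B} = 2^(log2 rho_AB - log2 (1_A \<otimes> rho_B)), zero eigenvalues of rho_AB
  handled by the eps -> 0+ limit.\<close>
definition cond_amp :: "complex^('a::finite\<times>'b::finite)^('a\<times>'b) \<Rightarrow> complex^('a::finite\<times>'b::finite)^('a\<times>'b)" where
  "cond_amp R = Lim (at_right (0::real))
     (\<lambda>eps. mat_fun (\<lambda>x. 2 powr x)
        (mat_fun (log 2) (regularise eps R) - mat_fun (log 2) (kron (mat 1) (ptrace_A R))))"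

end

theory Submission imports Defs begin

text \<open>Since \<open>\<rho>\<^sub>B = 1/2\<close> commutes with everything, \<open>\<rho>\<^bsub>A|B\<^esub>\<close> is just \<open>2\<rho>\<close>, so the condition says
  \<open>1 \<otimes> \<rho>\<^sub>B - \<rho> \<ge> 0\<close>. This is the reduction criterion, which every separable state satisfies.
  Conversely, a real singular value decomposition of the correlation matrix of \<open>\<rho>\<close> with
  right-handed singular bases gives
  \<open>4\<rho> = 1 + \<Sum>\<^sub>i s\<^sub>i (u\<^sub>i\<cdot>\<sigma>) \<otimes> (v\<^sub>i\<cdot>\<sigma>)\<close>. Testing \<open>\<rho> \<ge> 0\<close> and \<open>1 - 2\<rho> \<ge> 0\<close> against the four
  Bell states of these bases yields \<open>\<bar>s\<^sub>1\<bar> + \<bar>s\<^sub>2\<bar> + \<bar>s\<^sub>3\<bar> \<le> 1\<close>, so \<open>\<rho>\<close> is a convex combination of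
  the states \<open>(1 \<plusminus> (u\<^sub>i\<cdot>\<sigma>) \<otimes> (v\<^sub>i\<cdot>\<sigma>))/4\<close>, each a mixture of two product states.\<close>

section \<open>The spectral theorem for Hermitian matrices\<close>

lemma cadj_nth [simp]: "cadj A $ i $ j = cnj (A $ j $ i)"
  by (simp add: cadj_def)

lemma cdiag_nth: "cdiag d $ i $ j = (if i = j then d i else 0)"
  by (simp add: cdiag_def)

lemma mat_nth: "mat c $ i $ j = (if i = j then c else 0)"
  by (simp add: mat_def)

lemma matrix_mult_nth: "(A ** B) $ i $ j = (\<Sum>k\<in>UNIV. A $ i $ k * B $ k $ j)"
  by (simp add: matrix_matrix_mult_def)

lemma cadj_cadj [simp]: "cadj (cadj A) = A"
  by (simp add: vec_eq_iff)

lemma cadj_mat_1 [simp]: "cadj (mat 1) = mat 1"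
  by (simp add: vec_eq_iff mat_nth)

lemma cadj_mult: "cadj (A ** B) = cadj B ** cadj A"
  by (simp add: vec_eq_iff matrix_mult_nth mult.commute)

lemma cadj_add: "cadj (A + B) = cadj A + cadj B"
  and cadj_diff: "cadj (A - B) = cadj A - cadj B"
  and cadj_scaleR: "cadj (c *\<^sub>R A) = c *\<^sub>R cadj A"
  by (simp_all add: vec_eq_iff)

lemma mat_mult_nth: "(mat c ** A) $ i $ j = c * A $ i $ j"
  by (simp add: matrix_mult_nth mat_nth if_distrib [of "\<lambda>x. x * _"] cong: if_cong)

lemma mat_of_real_mult: "mat (complex_of_real c) ** A = c *\<^sub>R A"
  by (simp add: vec_eq_iff mat_mult_nth scaleR_conv_of_real[where 'a = complex])

lemma mat_eq_scaleR: "(mat (complex_of_real c) :: complex^'n^'n) = c *\<^sub>R mat 1"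
  using mat_of_real_mult[of c "mat 1 :: complex^'n^'n"] by simp

lemma conj_cdiag_nth:
  "(U ** cdiag d ** cadj U) $ i $ j = (\<Sum>k\<in>UNIV. U $ i $ k * d k * cnj (U $ j $ k))"
proof -
  have "(U ** cdiag d) $ i $ k = U $ i $ k * d k" for k
    by (simp add: matrix_mult_nth cdiag_nth if_distrib [of "\<lambda>x. _ * x"] cong: if_cong)
  then show ?thesis
    by (simp add: matrix_mult_nth [of _ "cadj U"])
qed

lemma unitary_right: "unitary U \<Longrightarrow> U ** cadj U = mat 1"
  by (simp add: unitary_def matrix_left_right_inverse)

text \<open>Conjugate-linear in the first argument. Its real part is the real inner product of the
  library, so compactness and dimension arguments can run over the underlying real space, while
  orthonormal columns of a unitary matrix need the full complex value.\<close>

definition cip :: "complex^'n \<Rightarrow> complex^'n \<Rightarrow> complex" where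
  "cip x y = (\<Sum>i\<in>UNIV. cnj (x $ i) * y $ i)"

lemma Re_cip: "Re (cip x y) = x \<bullet> y"
  by (simp add: cip_def inner_vec_def inner_complex_def Re_sum)

lemma cip_adj: "cip x (A *v y) = cip (cadj A *v x) y"
proof -
  have "cip x (A *v y) = (\<Sum>i\<in>UNIV. \<Sum>j\<in>UNIV. cnj (x $ i) * (A $ i $ j * y $ j))"
    by (simp add: cip_def matrix_vector_mult_def sum_distrib_left)
  also have "\<dots> = (\<Sum>j\<in>UNIV. \<Sum>i\<in>UNIV. cnj (x $ i) * (A $ i $ j * y $ j))"
    by (rule sum.swap)
  also have "\<dots> = cip (cadj A *v x) y"
    by (simp add: cip_def matrix_vector_mult_def sum_distrib_left sum_distrib_right mult_ac)
  finally show ?thesis .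
qed

lemma psd_iff: "psd A \<longleftrightarrow> hermitian A \<and> (\<forall>x. x \<bullet> (A *v x) \<ge> 0)"
  by (simp add: psd_def flip: Re_cip cip_def)

lemma hermitian_inner: "hermitian A \<Longrightarrow> x \<bullet> (A *v y) = (A *v x) \<bullet> y"
  by (metis Re_cip cip_adj hermitian_def)

lemma cip_add_right: "cip x (y + z) = cip x y + cip x z"
  and cip_scaleR_right: "cip x (c *\<^sub>R y) = c *\<^sub>R cip x y"
  and cip_scaleR_left: "cip (c *\<^sub>R x) y = c *\<^sub>R cip x y"
  and cip_smult_left: "cip (a *s x) y = cnj a * cip x y"
  and cip_0_right: "cip x 0 = 0"
  by (simp_all add: cip_def distrib_left sum.distrib scaleR_sum_right sum_distrib_left mult.assoc)

lemma cip_commute: "cip y x = cnj (cip x y)"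
  by (simp add: cip_def mult.commute)

lemma cip_self: "cip x x = complex_of_real (x \<bullet> x)"
  using Re_cip[of x x] cip_commute[of x x]
  by (simp add: complex_eq_iff)

lemma continuous_on_mult_vec: "continuous_on S (\<lambda>x. (A :: complex^'n^'m) *v x)"
  by (rule linear_continuous_on, rule bounded_linearI')
     (simp_all add: vec_eq_iff matrix_vector_mult_def sum.distrib algebra_simps scaleR_sum_right)

text \<open>A term linear in \<open>e\<close> outweighs a quadratic one for small \<open>e\<close>
  of the right sign. This forces a first variation to vanish at a maximum.\<close>

lemma quadratic_nonneg_imp_zero:
  fixes a K :: real
  assumes "\<And>e. 2 * e * a \<le> e\<^sup>2 * K"
  shows "a = 0"
proof (rule ccontr)
  assume a: "a \<noteq> 0"
  \<comment> \<open>\<open>e\<close> has the sign of \<open>a\<close>, and its size turns the bound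
    into \<open>2 * (e * a) \<le> e * a\<close>.\<close>
  define e where "e = a / (\<bar>K\<bar> + 1)"
  have "2 * (e * a) \<le> e\<^sup>2 * K" using assms[of e] by (simp add: mult.assoc)
  also have "\<dots> \<le> e\<^sup>2 * (\<bar>K\<bar> + 1)" by (intro mult_left_mono) auto
  also have "\<dots> = e * a" by (simp add: e_def power2_eq_square)
  finally have "e * a \<le> 0" by linarith
  moreover have "e * a > 0" using a unfolding e_def
    by (metis abs_ge_zero add_nonneg_pos divide_pos_pos not_real_square_gt_zero times_divide_eq_left zero_less_one)
  ultimately show False by simp
qed

text \<open>A maximiser of the quadratic form on the unit sphere of an invariant subspace is an eigenvector.\<close>

lemma hermitian_eigenvector_in_subspace:
  fixes A :: "complex^'n^'n"
  assumes A: "hermitian A" and S: "subspace S" and inv: "\<And>x. x \<in> S \<Longrightarrow> A *v x \<in> S"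
    and ne: "\<exists>x\<in>S. x \<noteq> 0"
  shows "\<exists>x\<in>S. \<exists>m::real. x \<bullet> x = 1 \<and> A *v x = m *\<^sub>R x"
proof -
  obtain z where z: "z \<in> S" "z \<noteq> 0" using ne by blast
  define C where "C = S \<inter> sphere 0 1"
  have "compact C" unfolding C_def
    by (intro closed_Int_compact closed_subspace S compact_sphere)
  moreover have "z /\<^sub>R norm z \<in> C" using z S by (simp add: C_def subspace_scale)
  then have "C \<noteq> {}" by blast
  moreover have "continuous_on C (\<lambda>y. y \<bullet> (A *v y))"
    by (intro continuous_on_inner continuous_on_id continuous_on_mult_vec)
  ultimately have "\<exists>x\<in>C. \<forall>y\<in>C. y \<bullet> (A *v y) \<le> x \<bullet> (A *v x)"
    by (rule continuous_attains_sup)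
  then obtain x where x: "x \<in> C" and max: "\<And>y. y \<in> C \<Longrightarrow> y \<bullet> (A *v y) \<le> x \<bullet> (A *v x)"
    by blast
  define m where "m = x \<bullet> (A *v x)"
  have xS: "x \<in> S" and xx: "x \<bullet> x = 1" using x by (auto simp: C_def norm_eq_1)
  \<comment> \<open>By homogeneity the maximum over the unit sphere bounds the form on all of
    \<open>S\<close>.\<close>
  have bound: "y \<bullet> (A *v y) \<le> m * (y \<bullet> y)" if "y \<in> S" for y
  proof (cases "y = 0")
    case False
    have "(y /\<^sub>R norm y) \<bullet> (A *v (y /\<^sub>R norm y)) \<le> m"
      unfolding m_def using that False S by (intro max) (simp add: C_def subspace_scale)
    moreover have "A *v (y /\<^sub>R norm y) = (A *v y) /\<^sub>R norm y"
      by (simp add: vec_eq_iff matrix_vector_mult_def scaleR_sum_right)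
    ultimately show ?thesis
      using False by (simp add: field_simps dot_square_norm power2_eq_square)
  qed simp
  \<comment> \<open>The defect of the eigenvector equation. It lies in \<open>S\<close>, so
    \<open>x\<close> may be moved along it; inserting \<open>x + e *\<^sub>R w\<close> into
    \<open>bound\<close> leaves \<open>2 * e * (w \<bullet> w)\<close> as the first-order
    term.\<close>
  define w where "w = A *v x - m *\<^sub>R x"
  have wS: "w \<in> S" unfolding w_def using S inv xS by (simp add: subspace_diff subspace_scale)
  have wx: "w \<bullet> x = 0" by (simp add: w_def inner_diff_left xx) (simp add: m_def inner_commute)
  have wA: "w \<bullet> (A *v x) = w \<bullet> w"
    using wx by (simp add: w_def inner_diff_right)
  have "2 * e * (w \<bullet> w) \<le> e\<^sup>2 * (m * (w \<bullet> w) - w \<bullet> (A *v w))" for e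
  proof -
    have "A *v (x + e *\<^sub>R w) = A *v x + e *\<^sub>R (A *v w)"
      by (simp add: vec_eq_iff matrix_vector_mult_def scaleR_sum_right algebra_simps sum.distrib)
    moreover have "x \<bullet> (A *v w) = w \<bullet> w"
      using wA hermitian_inner[OF A] by (metis inner_commute)
    moreover have "x \<bullet> w = 0" using wx by (simp add: inner_commute)
    ultimately show ?thesis
      using bound[of "x + e *\<^sub>R w"] xS wS S wA wx xx
      by (simp add: subspace_add subspace_scale inner_add_left inner_add_right
          flip: m_def) (simp add: algebra_simps power2_eq_square)
  qed
  then have "w \<bullet> w = 0" by (rule quadratic_nonneg_imp_zero)
  then have "A *v x = m *\<^sub>R x" by (simp add: w_def)
  then show ?thesis using xS xx by blast
qed

text \<open>The complex orthogonal complement of the eigenvectors found so far is invariant because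
  \<open>A\<close> is Hermitian, so it contains a further unit eigenvector. Subsets \<open>I\<close>
  of the matrix index type permit induction, and the vectors can then serve as columns.\<close>

lemma hermitian_eigenbasis:
  fixes A :: "complex^'n^'n"
  assumes A: "hermitian A"
  shows "\<exists>(f :: 'n \<Rightarrow> complex^'n) d. (\<forall>i\<in>I. A *v f i = (d i :: real) *\<^sub>R f i) \<and>
    (\<forall>i\<in>I. \<forall>j\<in>I. cip (f i) (f j) = (if i = j then 1 else 0))"
proof -
  have "finite I" by simp
  then show ?thesis
  proof (induction I rule: finite_induct)
    case (insert k I)
    then obtain f :: "'n \<Rightarrow> complex^'n" and d :: "'n \<Rightarrow> real"
      where eig: "\<And>i. i \<in> I \<Longrightarrow> A *v f i = d i *\<^sub>R f i"
        and on: "\<And>i j. i \<in> I \<Longrightarrow> j \<in> I \<Longrightarrow> cip (f i) (f j) = (if i = j then 1 else 0)"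
      by blast
    define S where "S = {x. \<forall>i\<in>I. cip (f i) x = 0}"
    have "subspace S"
      by (auto simp: S_def subspace_def cip_add_right cip_scaleR_right cip_0_right)
    moreover have "A *v x \<in> S" if "x \<in> S" for x
      using that A by (auto simp: S_def cip_adj hermitian_def eig cip_scaleR_left)
    moreover have "\<exists>x\<in>S. x \<noteq> 0"
    proof -
      \<comment> \<open>Real orthogonality to \<open>f i\<close> and to its multiple by the
        imaginary unit amounts to complex orthogonality. The real dimension is twice the number of
        indices, so at most \<open>2 * card I\<close> vectors cannot fill the space.\<close>
      define B where "B = f ` I \<union> (\<lambda>i. \<i> *s f i) ` I"
      have "dim B \<le> card B" by (rule dim_le_card') (simp add: B_def insert.hyps)
      also have "\<dots> \<le> card I + card I"
        unfolding B_def by (rule card_Un_le [THEN order_trans]) (intro add_mono card_image_le; simp)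
      also have "\<dots> < 2 * card (UNIV :: 'n set)"
      proof -
        have "card I < card (UNIV :: 'n set)"
          using insert.hyps by (intro psubset_card_mono) auto
        then show ?thesis by simp
      qed
      also have "\<dots> = DIM(complex^'n)" by simp
      finally obtain x where x: "x \<noteq> 0" "\<And>y. y \<in> span B \<Longrightarrow> orthogonal x y"
        using orthogonal_to_subspace_exists by blast
      have "cip (f i) x = 0" if "i \<in> I" for i
      proof -
        have "f i \<bullet> x = 0" "(\<i> *s f i) \<bullet> x = 0"
          using x(2)[OF span_base, of "f i"] x(2)[OF span_base, of "\<i> *s f i"] that
          by (auto simp: B_def orthogonal_def inner_commute)
        then show ?thesis
          by (auto simp: complex_eq_iff cip_smult_left simp flip: Re_cip)
      qed
      then show ?thesis using x(1) by (auto simp: S_def)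
    qed
    ultimately obtain x m where x: "x \<in> S" "x \<bullet> x = 1" "A *v x = m *\<^sub>R x"
      using hermitian_eigenvector_in_subspace[OF A] by blast
    have fx: "cip (f i) x = 0" "cip x (f i) = 0" if "i \<in> I" for i
      using x(1) that cip_commute[of x "f i"] by (auto simp: S_def)
    show ?case
      by (rule exI[of _ "f(k := x)"], rule exI[of _ "d(k := m)"])
        (use insert.hyps fx x cip_self[of x] on in \<open>auto simp: eig\<close>)
  qed simp
qed

theorem spectral_hermitian:
  fixes A :: "complex^'n^'n"
  assumes "hermitian A"
  obtains U d where "unitary U" "A = U ** cdiag (\<lambda>i. complex_of_real (d i)) ** cadj U"
proof -
  obtain f :: "'n \<Rightarrow> complex^'n" and d
    where eig: "\<And>i. A *v f i = d i *\<^sub>R f i"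
      and on: "\<And>i j. cip (f i) (f j) = (if i = j then 1 else 0)"
    using hermitian_eigenbasis[OF assms, of UNIV] by auto
  define U where "U = (\<chi> i j. f j $ i)"
  have U: "unitary U"
    using on by (simp add: unitary_def vec_eq_iff matrix_mult_nth mat_nth U_def cip_def)
  have "A ** U = U ** cdiag (\<lambda>i. complex_of_real (d i))"
  proof -
    have "(A ** U) $ i $ j = (A *v f j) $ i" for i j
      by (simp add: matrix_mult_nth matrix_vector_mult_def U_def)
    then show ?thesis
      by (simp add: vec_eq_iff eig matrix_mult_nth [of U] cdiag_nth if_distrib [of "\<lambda>x. _ * x"]
          cong: if_cong) (simp add: U_def scaleR_conv_of_real)
  qed
  then have "A = U ** cdiag (\<lambda>i. complex_of_real (d i)) ** cadj U"
    by (metis U matrix_mul_assoc matrix_mul_rid unitary_right)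
  with U show thesis by (rule that)
qed

section \<open>Functional calculus and the conditional amplitude operator\<close>

text \<open>Makes the \<open>THE\<close> in \<open>mat_fun\<close> well defined. The change of basis
  \<open>cadj V ** U\<close> intertwines the two diagonal matrices, so it links only equal
  eigenvalues, on which \<open>f\<close> takes equal values.\<close>

lemma mat_fun_unitary_unique:
  assumes U: "unitary U" and V: "unitary V"
    and eq: "U ** cdiag (\<lambda>i. complex_of_real (d i)) ** cadj U
      = V ** cdiag (\<lambda>i. complex_of_real (e i)) ** cadj V"
  shows "U ** cdiag (\<lambda>i. complex_of_real (f (d i))) ** cadj U
      = V ** cdiag (\<lambda>i. complex_of_real (f (e i))) ** cadj V"
proof -
  define W where "W = cadj V ** U"
  have W_nth: "(W ** cdiag g) $ i $ j = W $ i $ j * g j" "(cdiag g ** W) $ i $ j = g i * W $ i $ j" for g i j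
    by (simp_all add: matrix_mult_nth cdiag_nth if_distrib [of "\<lambda>x. _ * x"] if_distrib [of "\<lambda>x. x * _"]
        cong: if_cong)
  have UW: "V ** W = U"
    by (simp add: W_def matrix_mul_assoc unitary_right V)
  have "W ** cdiag (\<lambda>i. complex_of_real (d i))
      = cadj V ** (U ** cdiag (\<lambda>i. complex_of_real (d i)) ** cadj U) ** U"
    using U unfolding W_def unitary_def
    by (metis matrix_mul_assoc matrix_mul_rid)
  also have "\<dots> = cdiag (\<lambda>i. complex_of_real (e i)) ** W"
    using V unfolding W_def unitary_def eq
    by (metis matrix_mul_assoc matrix_mul_lid)
  finally have "W $ i $ j * complex_of_real (d j) = complex_of_real (e i) * W $ i $ j" for i j
    by (metis W_nth)
  \<comment> \<open>Either the entry of \<open>W\<close> vanishes or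
    \<open>d j = e i\<close>.\<close>
  then have "W $ i $ j * complex_of_real (f (d j)) = complex_of_real (f (e i)) * W $ i $ j" for i j
    by (metis mult.commute mult_cancel_left of_real_eq_iff)
  then have "W ** cdiag (\<lambda>i. complex_of_real (f (d i))) = cdiag (\<lambda>i. complex_of_real (f (e i))) ** W"
    by (simp add: vec_eq_iff W_nth)
  then have "U ** cdiag (\<lambda>i. complex_of_real (f (d i))) ** cadj U
      = V ** cdiag (\<lambda>i. complex_of_real (f (e i))) ** (W ** cadj U)"
    by (metis UW matrix_mul_assoc)
  also have "W ** cadj U = cadj V"
    by (metis W_def U matrix_mul_assoc matrix_mul_rid unitary_right)
  finally show ?thesis .
qed

lemma mat_fun_spectral:
  assumes "unitary U"
  shows "mat_fun f (U ** cdiag (\<lambda>i. complex_of_real (d i)) ** cadj U)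
    = U ** cdiag (\<lambda>i. complex_of_real (f (d i))) ** cadj U"
  unfolding mat_fun_def
  by (rule the_equality) (use assms in blast, use assms mat_fun_unitary_unique in metis)

lemma unitary_conj_scaleR:
  "c *\<^sub>R (U ** cdiag d ** cadj U) = U ** cdiag (\<lambda>i. c *\<^sub>R d i) ** cadj U"
  by (simp add: vec_eq_iff conj_cdiag_nth scaleR_sum_right)

text \<open>Allows a scalar to be subtracted eigenvalue by eigenvalue in a basis chosen for another
  operator.\<close>

lemma mat_eq_unitary_conj: "unitary U \<Longrightarrow> mat c = U ** cdiag (\<lambda>_. c) ** cadj U"
proof -
  assume U: "unitary U"
  have "c * (U ** cadj U) $ i $ j = (U ** cdiag (\<lambda>_. c) ** cadj U) $ i $ j" for i j
    unfolding conj_cdiag_nth by (simp add: matrix_mult_nth sum_distrib_left mult_ac)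
  then show ?thesis
    by (simp add: vec_eq_iff unitary_right [OF U] mat_nth) (metis mult.right_neutral mult_zero_right)
qed

lemma mat_fun_mat:
  "mat_fun f (mat (complex_of_real c) :: complex^'n^'n) = mat (complex_of_real (f c))"
proof -
  have "unitary (mat 1 :: complex^'n^'n)" by (simp add: unitary_def)
  then show ?thesis
    using mat_fun_spectral[of "mat 1 :: complex^'n^'n" f "\<lambda>_. c"]
    by (metis mat_eq_unitary_conj)
qed

lemma kron_mat_mat: "kron (mat a) (mat b) = mat (a * b)"
  by (auto simp: vec_eq_iff kron_def mat_nth)

section \<open>Positivity read off from the eigenvalues\<close>

lemma cip_spectral:
  "cip x (U ** cdiag (\<lambda>i. complex_of_real (d i)) ** cadj U *v x)
    = (\<Sum>k\<in>UNIV. complex_of_real (d k * (cmod ((cadj U *v x) $ k))\<^sup>2))"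
proof -
  have "cip x (U ** cdiag (\<lambda>i. complex_of_real (d i)) ** cadj U *v x)
      = cip (cadj U *v x) (cdiag (\<lambda>i. complex_of_real (d i)) *v (cadj U *v x))"
    by (metis cip_adj matrix_vector_mul_assoc)
  moreover have "(cdiag (\<lambda>i. complex_of_real (d i)) *v y) $ k = complex_of_real (d k) * y $ k" for y k
    by (simp add: matrix_vector_mult_def cdiag_nth if_distrib [of "\<lambda>x. x * _"] cong: if_cong)
  ultimately show ?thesis
    by (simp add: cip_def complex_norm_square mult_ac del: of_real_power flip: of_real_power)
qed

lemma hermitian_spectral: "hermitian (U ** cdiag (\<lambda>i. complex_of_real (d i)) ** cadj U)"
  by (simp add: hermitian_def vec_eq_iff conj_cdiag_nth mult_ac)

lemma psd_spectral_iff: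
  assumes "unitary U"
  shows "psd (U ** cdiag (\<lambda>i. complex_of_real (d i)) ** cadj U) \<longleftrightarrow> (\<forall>i. d i \<ge> 0)"
proof
  assume "\<forall>i. d i \<ge> 0"
  then show "psd (U ** cdiag (\<lambda>i. complex_of_real (d i)) ** cadj U)"
    by (simp add: psd_iff hermitian_spectral cip_spectral sum_nonneg flip: Re_cip)
next
  assume psd: "psd (U ** cdiag (\<lambda>i. complex_of_real (d i)) ** cadj U)"
  show "\<forall>i. d i \<ge> 0"
  proof
    fix i
    \<comment> \<open>Testing on the \<open>i\<close>-th column of \<open>U\<close> isolates
      \<open>d i\<close>.\<close>
    define x where "x = U *v axis i 1"
    have "cadj U *v x = axis i 1"
      using assms by (simp add: x_def matrix_vector_mul_assoc unitary_def)
    then have "Re (cip x (U ** cdiag (\<lambda>i. complex_of_real (d i)) ** cadj U *v x))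
        = (\<Sum>k\<in>UNIV. if k = i then d i else 0)"
      unfolding cip_spectral Re_sum by (intro sum.cong) (auto simp: axis_def)
    then show "d i \<ge> 0"
      using psd by (simp add: psd_iff Re_cip) (metis (no_types))
  qed
qed

lemma psd_spectral:
  assumes "psd A"
  obtains U d where "unitary U" "\<And>i. d i \<ge> 0"
    "A = U ** cdiag (\<lambda>i. complex_of_real (d i)) ** cadj U"
proof -
  have "hermitian A" using assms by (simp add: psd_def)
  then obtain U d where U: "unitary U" and A: "A = U ** cdiag (\<lambda>i. complex_of_real (d i)) ** cadj U"
    by (rule spectral_hermitian)
  have "\<forall>i. d i \<ge> 0" using assms unfolding A psd_spectral_iff[OF U] .
  then show thesis using that U A by blast
qed

text \<open>The logarithm of a scalar marginal is scalar, so everything stays diagonal in an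
  eigenbasis of \<open>R\<close>, and a regularised eigenvalue \<open>x > 0\<close> becomes
  \<open>2 powr (log 2 x - log 2 c) = x / c\<close>.\<close>

lemma cond_amp_maximally_mixed_marginal:
  fixes R :: "complex^('a::finite\<times>'b::finite)^('a\<times>'b)"
  assumes "psd R" and c: "c > 0" and marg: "ptrace_A R = mat (complex_of_real c)"
  shows "cond_amp R = (1 / c) *\<^sub>R R"
proof -
  obtain U d where U: "unitary U" and d: "\<And>i. d i \<ge> 0"
    and R: "R = U ** cdiag (\<lambda>i. complex_of_real (d i)) ** cadj U"
    using psd_spectral[OF \<open>psd R\<close>] by metis
  define reg where "reg = (\<lambda>eps x :: real. if x = 0 then eps else x)"
  have reg_R: "regularise eps R = U ** cdiag (\<lambda>i. complex_of_real (reg eps (d i))) ** cadj U" for eps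
    unfolding regularise_def R reg_def by (rule mat_fun_spectral[OF U])
  have marg': "mat_fun (log 2) (kron (mat 1) (ptrace_A R))
      = (mat (complex_of_real (log 2 c)) :: complex^('a\<times>'b)^('a\<times>'b))"
    using mat_fun_mat[of "log 2" c] by (simp add: marg kron_mat_mat)
  have exponent: "mat_fun (log 2) (regularise eps R) - mat_fun (log 2) (kron (mat 1) (ptrace_A R))
      = U ** cdiag (\<lambda>i. complex_of_real (log 2 (reg eps (d i)) - log 2 c)) ** cadj U" for eps
    unfolding marg' reg_R mat_fun_spectral[OF U] mat_eq_unitary_conj[OF U, of "complex_of_real (log 2 c)"]
    by (simp add: vec_eq_iff conj_cdiag_nth algebra_simps sum_subtractf)
  have op: "mat_fun (\<lambda>x. 2 powr x)
      (mat_fun (log 2) (regularise eps R) - mat_fun (log 2) (kron (mat 1) (ptrace_A R)))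
      = U ** cdiag (\<lambda>i. complex_of_real (reg eps (d i) / c)) ** cadj U" if "eps > 0" for eps
  proof -
    have "reg eps (d i) > 0" for i using d[of i] that by (simp add: reg_def)
    then have "2 powr (log 2 (reg eps (d i)) - log 2 c) = reg eps (d i) / c" for i
      using c by (simp add: powr_diff)
    then show ?thesis unfolding exponent mat_fun_spectral[OF U] by simp
  qed
  \<comment> \<open>A zero eigenvalue is replaced by \<open>eps\<close>, which tends back to zero;
    the others do not depend on \<open>eps\<close>.\<close>
  have "((\<lambda>eps. reg eps x) \<longlongrightarrow> x) (at_right 0)" for x
    by (cases "x = 0") (auto simp: reg_def tendsto_ident_at)
  then have "((\<lambda>eps. U ** cdiag (\<lambda>i. complex_of_real (reg eps (d i) / c)) ** cadj U)
      \<longlongrightarrow> U ** cdiag (\<lambda>i. complex_of_real (d i / c)) ** cadj U) (at_right 0)"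
    by (intro vec_tendstoI) (unfold conj_cdiag_nth, intro tendsto_intros, use c in auto)
  then have "((\<lambda>eps. mat_fun (\<lambda>x. 2 powr x)
      (mat_fun (log 2) (regularise eps R) - mat_fun (log 2) (kron (mat 1) (ptrace_A R))))
      \<longlongrightarrow> U ** cdiag (\<lambda>i. complex_of_real (d i / c)) ** cadj U) (at_right 0)"
    by (rule Lim_transform_eventually)
       (use op in \<open>auto intro!: eventually_at_right_less [THEN eventually_mono]\<close>)
  then have "cond_amp R = U ** cdiag (\<lambda>i. complex_of_real (d i / c)) ** cadj U"
    unfolding cond_amp_def by (intro tendsto_Lim) auto
  also have "\<dots> = (1 / c) *\<^sub>R R"
    unfolding R unitary_conj_scaleR by (simp add: scaleR_conv_of_real)
  finally show ?thesis .
qed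

section \<open>Product states and the reduction criterion\<close>

lemma kron_nth: "kron A B $ p $ q = A $ fst p $ fst q * B $ snd p $ snd q"
  by (simp add: kron_def)

lemma kron_add_right: "kron C (A + B) = kron C A + kron C B"
  and kron_diff_left: "kron (A - B) C = kron A C - kron B C"
  and kron_scaleR_right: "kron C (r *\<^sub>R A) = r *\<^sub>R kron C A"
  by (simp_all add: vec_eq_iff kron_nth algebra_simps)

lemma cadj_kron: "cadj (kron A B) = kron (cadj A) (cadj B)"
  by (simp add: vec_eq_iff kron_nth)

lemma kron_mult: "kron A B ** kron C D = kron (A ** C) (B ** D)"
proof -
  have "(kron A B ** kron C D) $ p $ q
      = (\<Sum>(i, j)\<in>UNIV \<times> UNIV. (A $ fst p $ i * C $ i $ fst q) * (B $ snd p $ j * D $ j $ snd q))" for p q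
    by (simp add: matrix_mult_nth kron_nth case_prod_unfold mult_ac)
  then show ?thesis
    by (simp add: vec_eq_iff kron_nth matrix_mult_nth sum_product sum.cartesian_product)
qed

lemma ctrace_kron: "ctrace (kron A B) = ctrace A * ctrace B"
  unfolding ctrace_def kron_nth sum_product sum.cartesian_product
  by (simp add: case_prod_unfold)

section \<open>Gram factorisations and closure properties of positivity\<close>

lemma psd_cadj_mult: "psd (cadj S ** S)"
proof -
  have "x \<bullet> (cadj S ** S *v x) = (S *v x) \<bullet> (S *v x)" for x
    by (metis Re_cip cadj_cadj cip_adj matrix_vector_mul_assoc)
  then show ?thesis by (simp add: psd_iff hermitian_def cadj_mult)
qed

text \<open>Take the square roots of the eigenvalues after the change of basis
  \<open>cadj U\<close>. This factorisation turns positivity of Kronecker products and of traces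
  into algebra.\<close>

lemma psd_imp_cadj_mult:
  assumes "psd A"
  shows "\<exists>S. A = cadj S ** S"
proof -
  obtain U d where U: "unitary U" and d: "\<And>i. d i \<ge> 0"
    and A: "A = U ** cdiag (\<lambda>i. complex_of_real (d i)) ** cadj U"
    using psd_spectral[OF assms] by metis
  define D where "D = cdiag (\<lambda>i. complex_of_real (sqrt (d i)))"
  have "cadj D = D" by (simp add: D_def vec_eq_iff cdiag_nth)
  moreover have "D ** D = cdiag (\<lambda>i. complex_of_real (d i))"
    using d by (auto simp: D_def vec_eq_iff matrix_mult_nth cdiag_nth if_distrib [of "\<lambda>x. x * _"]
        simp flip: of_real_mult cong: if_cong)
  ultimately have "A = cadj (D ** cadj U) ** (D ** cadj U)"
    by (metis A cadj_cadj cadj_mult matrix_mul_assoc)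
  then show ?thesis by blast
qed

lemma psd_kron: "psd A \<Longrightarrow> psd B \<Longrightarrow> psd (kron A B)"
  by (metis psd_imp_cadj_mult psd_cadj_mult cadj_kron kron_mult)

lemma psd_add: "psd A \<Longrightarrow> psd B \<Longrightarrow> psd (A + B)"
  by (simp add: psd_iff hermitian_def cadj_add matrix_vector_mult_add_rdistrib inner_add_right)

lemma scaleR_matrix_vector: "(r *\<^sub>R A) *v x = r *\<^sub>R (A *v x)" for A :: "complex^'n^'m"
  by (simp add: vec_eq_iff matrix_vector_mult_def scaleR_sum_right)

lemma psd_scaleR: "psd A \<Longrightarrow> r \<ge> 0 \<Longrightarrow> psd (r *\<^sub>R A)"
  by (simp add: psd_iff hermitian_def cadj_scaleR scaleR_matrix_vector)

text \<open>Nonnegative eigenvalues that sum to the trace \<open>1\<close> are each at most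
  \<open>1\<close>.\<close>

lemma psd_mat_1_diff_density:
  assumes "density A"
  shows "psd (mat 1 - A)"
proof -
  have "psd A" using assms by (simp add: density_def)
  then obtain U d where U: "unitary U" and d: "\<And>i. d i \<ge> 0"
    and A: "A = U ** cdiag (\<lambda>i. complex_of_real (d i)) ** cadj U"
    using psd_spectral by metis
  have "ctrace A = (\<Sum>k\<in>UNIV. \<Sum>i\<in>UNIV. complex_of_real (d k) * (cnj (U $ i $ k) * U $ i $ k))"
    unfolding A ctrace_def conj_cdiag_nth by (subst sum.swap) (simp add: mult_ac)
  also have "\<dots> = (\<Sum>k\<in>UNIV. complex_of_real (d k) * (cadj U ** U) $ k $ k)"
    by (simp add: matrix_mult_nth sum_distrib_left)
  also have "\<dots> = complex_of_real (\<Sum>k\<in>UNIV. d k)"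
    using U by (simp add: unitary_def mat_nth)
  finally have "(\<Sum>k\<in>UNIV. d k) = 1"
    using assms by (simp add: density_def) (metis of_real_eq_1_iff of_real_sum)
  then have d1: "d k \<le> 1" for k
    using member_le_sum[of k UNIV d] d by simp
  have "mat 1 - A = U ** cdiag (\<lambda>i. complex_of_real (1 - d i)) ** cadj U"
    unfolding A mat_eq_unitary_conj[OF U, of 1]
    by (simp add: vec_eq_iff conj_cdiag_nth algebra_simps sum_subtractf)
  then show ?thesis
    using psd_spectral_iff[OF U, of "\<lambda>i. 1 - d i"] d1 by simp
qed

definition product_states :: "(complex^('a::finite\<times>'b::finite)^('a\<times>'b)) set" where
  "product_states = {kron A B | A B. density A \<and> density B}"

text \<open>Gives access to convexity in both directions: minimality of the hull yields necessary
  conditions, and convex combinations exhibit separability.\<close>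

lemma separable_iff_convex_hull:
  fixes R :: "complex^('a::finite\<times>'b::finite)^('a\<times>'b)"
  shows "separable R \<longleftrightarrow> R \<in> convex hull product_states"
proof
  assume "separable R"
  then obtain n :: nat and p RA RB
    where pr: "\<And>k. k < n \<Longrightarrow> p k \<ge> 0 \<and> density (RA k) \<and> density (RB k)"
      and p1: "(\<Sum>k<n. p k) = 1"
      and R: "R = (\<Sum>k<n. p k *\<^sub>R kron (RA k) (RB k))"
    unfolding separable_def mat_of_real_mult by blast
  show "R \<in> convex hull product_states"
    unfolding R using pr p1
    by (intro convex_sum) (auto simp: product_states_def intro!: hull_inc)
next
  assume "R \<in> convex hull product_states"
  then obtain n :: nat and p x
    where px: "\<And>k. k \<in> {1..n} \<Longrightarrow> 0 \<le> p k \<and> x k \<in> product_states"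
      and p1: "sum p {1..n} = 1" and R: "(\<Sum>k\<in>{1..n}. p k *\<^sub>R x k) = R"
    unfolding convex_hull_indexed by blast
  obtain RA RB where x: "\<And>k. k \<in> {1..n} \<Longrightarrow> x k = kron (RA k) (RB k) \<and> density (RA k) \<and> density (RB k)"
    using px unfolding product_states_def mem_Collect_eq by metis
  \<comment> \<open>The indexed description of the hull counts from 1, \<open>separable\<close> from
    0.\<close>
  have shift: "(\<Sum>k<n. f (Suc k)) = sum f {1..n}" for f :: "nat \<Rightarrow> 'z::comm_monoid_add"
    by (rule sum.reindex_bij_witness[of _ "\<lambda>k. k - 1" Suc]) auto
  have "R = (\<Sum>k\<in>{1..n}. p k *\<^sub>R kron (RA k) (RB k))"
    unfolding R[symmetric] using x by (intro sum.cong) auto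
  then have "R = (\<Sum>k<n. p (Suc k) *\<^sub>R kron (RA (Suc k)) (RB (Suc k)))"
    using shift[of "\<lambda>k. p k *\<^sub>R kron (RA k) (RB k)"] by simp
  moreover have "(\<Sum>k<n. p (Suc k)) = 1" using p1 by (simp add: shift)
  moreover have "\<forall>k<n. p (Suc k) \<ge> 0 \<and> density (RA (Suc k)) \<and> density (RB (Suc k))"
    using px x by auto
  ultimately show "separable R"
    unfolding separable_def mat_of_real_mult
    by (intro exI[of _ n] exI[of _ "\<lambda>k. p (Suc k)"] exI[of _ "\<lambda>k. RA (Suc k)"]
        exI[of _ "\<lambda>k. RB (Suc k)"] conjI)
qed

lemma ptrace_A_kron: "ptrace_A (kron A B) = mat (ctrace A) ** B"
  by (simp add: vec_eq_iff ptrace_A_def kron_nth ctrace_def matrix_mult_nth mat_nth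
      sum_distrib_right if_distrib [of "\<lambda>x. x * _"] cong: if_cong)

lemma ptrace_A_add: "ptrace_A (R + S) = ptrace_A R + ptrace_A S"
  and ptrace_A_scaleR: "ptrace_A (r *\<^sub>R R) = r *\<^sub>R ptrace_A R"
  by (simp_all add: vec_eq_iff ptrace_A_def sum.distrib scaleR_sum_right)

text \<open>On product states the condition reads \<open>(1 - \<rho>\<^sub>A) \<otimes> \<rho>\<^sub>B \<ge> 0\<close>, and it is convex.\<close>

theorem separable_imp_reduction:
  fixes R :: "complex^('a::finite\<times>'b::finite)^('a\<times>'b)"
  assumes "separable R"
  shows "psd (kron (mat 1) (ptrace_A R) - R)"
proof -
  let ?C = "{R :: complex^('a\<times>'b)^('a\<times>'b). psd (kron (mat 1) (ptrace_A R) - R)}"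
  have "product_states \<subseteq> ?C"
  proof
    fix R :: "complex^('a\<times>'b)^('a\<times>'b)"
    assume "R \<in> product_states"
    then obtain A B where R: "R = kron A B" "density A" "density B"
      by (auto simp: product_states_def)
    then have "kron (mat 1) (ptrace_A R) - R = kron (mat 1 - A) B"
      by (simp add: ptrace_A_kron density_def kron_diff_left)
    then show "R \<in> ?C"
      using R by (simp add: psd_kron psd_mat_1_diff_density density_def)
  qed
  moreover have "convex ?C"
  proof (rule convexI)
    fix R S :: "complex^('a\<times>'b)^('a\<times>'b)" and r s :: real
    assume *: "R \<in> ?C" "S \<in> ?C" "r \<ge> 0" "s \<ge> 0"
    have "kron (mat 1) (ptrace_A (r *\<^sub>R R + s *\<^sub>R S)) - (r *\<^sub>R R + s *\<^sub>R S)
        = r *\<^sub>R (kron (mat 1) (ptrace_A R) - R) + s *\<^sub>R (kron (mat 1) (ptrace_A S) - S)"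
      by (simp add: ptrace_A_add ptrace_A_scaleR kron_add_right kron_scaleR_right algebra_simps)
    then show "r *\<^sub>R R + s *\<^sub>R S \<in> ?C"
      using * by (simp add: psd_add psd_scaleR)
  qed
  ultimately have "convex hull product_states \<subseteq> ?C" by (rule hull_minimal)
  then show ?thesis using assms by (auto simp: separable_iff_convex_hull)
qed

section \<open>Singular value decomposition in dimension three\<close>

text \<open>On the unit circle through \<open>u\<close> and \<open>w\<close> the functional reaches
  \<open>sqrt ((u \<bullet> y)^2 + (w \<bullet> y)^2)\<close>, which exceeds
  \<open>u \<bullet> y\<close> unless \<open>w \<bullet> y\<close> is zero.\<close>

lemma maximal_on_circle_imp_orthogonal:
  fixes u w y :: "'a::real_inner"
  assumes S: "subspace S" and u: "u \<in> S" "norm u = 1" and w: "w \<in> S" "norm w = 1"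
    and uw: "u \<bullet> w = 0" and max: "\<And>x. x \<in> S \<Longrightarrow> norm x = 1 \<Longrightarrow> x \<bullet> y \<le> u \<bullet> y"
  shows "w \<bullet> y = 0"
proof (rule ccontr)
  assume b: "w \<bullet> y \<noteq> 0"
  define a b where "a = u \<bullet> y" and "b = w \<bullet> y"
  define r where "r = sqrt (a\<^sup>2 + b\<^sup>2)"
  have r: "r > 0" "r\<^sup>2 = a\<^sup>2 + b\<^sup>2" using b by (simp_all add: r_def b_def add_nonneg_pos)
  \<comment> \<open>The normalised projection of \<open>y\<close> onto the plane of \<open>u\<close>
    and \<open>w\<close>.\<close>
  define x where "x = (1 / r) *\<^sub>R (a *\<^sub>R u + b *\<^sub>R w)"
  have "(a *\<^sub>R u + b *\<^sub>R w) \<bullet> (a *\<^sub>R u + b *\<^sub>R w) = r\<^sup>2"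
    using u w uw unfolding r(2)
    by (simp add: inner_add_left inner_add_right inner_commute[of w u] power2_eq_square norm_eq_1)
  then have "norm (a *\<^sub>R u + b *\<^sub>R w) = r"
    using r(1) by (simp add: norm_eq_sqrt_inner)
  then have "norm x = 1" using r(1) by (simp add: x_def)
  moreover have "x \<in> S" using S u w by (simp add: x_def subspace_scale subspace_add)
  ultimately have "x \<bullet> y \<le> a" using max by (simp add: a_def)
  moreover have "x \<bullet> y = r\<^sup>2 / r"
    unfolding r(2) by (simp add: x_def inner_add_left power2_eq_square flip: a_def b_def)
  ultimately have "r \<le> a" using r(1) by (simp add: power2_eq_square)
  then have "r\<^sup>2 \<le> a\<^sup>2" using r(1) by (intro power_mono) auto
  then show False using r(2) b by (simp add: b_def)
qed

lemma subspace_unit_sphere_nonempty: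
  fixes V :: "'a::real_normed_vector set"
  assumes V: "subspace V" "\<exists>x\<in>V. x \<noteq> 0"
  shows "V \<inter> sphere 0 1 \<noteq> {}"
proof -
  obtain x where "x \<in> V" "x \<noteq> 0" using V by blast
  then have "x /\<^sub>R norm x \<in> V \<inter> sphere 0 1" using V by (simp add: subspace_scale)
  then show ?thesis by blast
qed

text \<open>A joint maximiser over two unit spheres is maximal in each argument separately, so the
  mixed terms with orthogonal directions vanish. This is one step of a singular value
  decomposition.\<close>

lemma bilinear_form_max:
  fixes T :: "real^'n^'m"
  assumes "subspace S" "subspace S'" "\<exists>x\<in>S. x \<noteq> 0" "\<exists>x\<in>S'. x \<noteq> 0"
  obtains u v where "u \<in> S" "norm u = 1" "v \<in> S'" "norm v = 1"
    "\<And>w. w \<in> S \<Longrightarrow> norm w = 1 \<Longrightarrow> u \<bullet> w = 0 \<Longrightarrow> w \<bullet> (T *v v) = 0"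
    "\<And>w. w \<in> S' \<Longrightarrow> norm w = 1 \<Longrightarrow> v \<bullet> w = 0 \<Longrightarrow> u \<bullet> (T *v w) = 0"
proof -
  define K where "K = (S \<inter> sphere 0 1) \<times> (S' \<inter> sphere 0 1)"
  have "compact K" unfolding K_def
    by (intro compact_Times closed_Int_compact closed_subspace assms compact_sphere)
  moreover have "K \<noteq> {}" using assms by (simp add: K_def subspace_unit_sphere_nonempty)
  moreover have "continuous_on K (\<lambda>p. fst p \<bullet> (T *v snd p))"
    by (intro continuous_intros continuous_on_compose2[OF matrix_vector_mult_linear_continuous_on]) auto
  ultimately have "\<exists>p\<in>K. \<forall>q\<in>K. fst q \<bullet> (T *v snd q) \<le> fst p \<bullet> (T *v snd p)"
    by (rule continuous_attains_sup)
  then obtain u v where uv: "u \<in> S" "norm u = 1" "v \<in> S'" "norm v = 1"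
    and max: "\<And>x y. x \<in> S \<Longrightarrow> norm x = 1 \<Longrightarrow> y \<in> S' \<Longrightarrow> norm y = 1 \<Longrightarrow> x \<bullet> (T *v y) \<le> u \<bullet> (T *v v)"
    by (auto simp: K_def)
  \<comment> \<open>The transpose puts variation of the second argument into the same form as
    variation of the first.\<close>
  have adj: "x \<bullet> (T *v y) = y \<bullet> (transpose T *v x)" for x y
    by (metis dot_lmul_matrix inner_commute transpose_matrix_vector)
  show thesis
  proof
    fix w assume w: "w \<in> S" "norm w = 1" "u \<bullet> w = 0"
    show "w \<bullet> (T *v v) = 0"
      by (rule maximal_on_circle_imp_orthogonal[OF assms(1) uv(1,2) w]) (use max uv in auto)
  next
    fix w assume w: "w \<in> S'" "norm w = 1" "v \<bullet> w = 0"
    show "u \<bullet> (T *v w) = 0" unfolding adj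
      by (rule maximal_on_circle_imp_orthogonal[OF assms(2) uv(3,4) w]) (use max uv adj in auto)
  qed (fact uv)+
qed

lemma norm_cross3_orthonormal:
  assumes "norm u = 1" "norm v = 1" "u \<bullet> v = 0"
  shows "norm (cross3 u v) = 1"
  using norm_cross_dot[of u v] assms by (simp add: power2_eq_1_iff) (metis abs_norm_cancel abs_minus_cancel abs_1)

text \<open>The remainder is orthogonal to \<open>u\<close>, \<open>v\<close> and
  \<open>cross3 u v\<close>. By Lagrange's identity its cross product with \<open>cross3 u v\<close>
  vanishes too, and a vector both parallel and orthogonal to a unit vector is zero.\<close>

lemma cross3_orthonormal_expansion:
  assumes "norm u = 1" "norm v = 1" "u \<bullet> v = 0"
  shows "x = (x \<bullet> u) *\<^sub>R u + (x \<bullet> v) *\<^sub>R v + (x \<bullet> cross3 u v) *\<^sub>R cross3 u v"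
proof -
  have w: "norm (cross3 u v) = 1" using assms by (rule norm_cross3_orthonormal)
  define y where "y = x - (x \<bullet> u) *\<^sub>R u - (x \<bullet> v) *\<^sub>R v - (x \<bullet> cross3 u v) *\<^sub>R cross3 u v"
  have y: "y \<bullet> u = 0" "y \<bullet> v = 0" "y \<bullet> cross3 u v = 0"
    using assms w by (simp_all add: y_def inner_diff_left dot_cross_self norm_eq_1 inner_commute[of v u])
  have "cross3 y (cross3 u v) = 0" using y by (simp add: Lagrange)
  then have "y = 0"
    using norm_cross_dot[of y "cross3 u v"] y w by simp
  then show ?thesis by (simp add: y_def algebra_simps)
qed

text \<open>Two maximisations suffice, the second on the orthogonal complements of \<open>u1\<close>
  and \<open>v1\<close>. Completing by cross products keeps both bases right-handed, at the price of
  coefficients that may be negative.\<close>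

theorem real3_svd:
  fixes T :: "real^3^3"
  obtains u1 u2 v1 v2 s1 s2 s3
  where "norm u1 = 1" "norm u2 = 1" "u1 \<bullet> u2 = 0" "norm v1 = 1" "norm v2 = 1" "v1 \<bullet> v2 = 0"
    "\<forall>m n. T $ m $ n = s1 * (u1 $ m * v1 $ n) + s2 * (u2 $ m * v2 $ n)
      + s3 * (cross3 u1 u2 $ m * cross3 v1 v2 $ n)"
proof -
  have nz: "\<exists>x\<in>UNIV. (x :: real^3) \<noteq> 0"
    by (rule bexI[of _ "axis 1 1"]) (auto simp: axis_eq_0_iff)
  obtain u1 v1 where 1: "norm u1 = 1" "norm v1 = 1"
    and u1: "\<And>w. norm w = 1 \<Longrightarrow> u1 \<bullet> w = 0 \<Longrightarrow> w \<bullet> (T *v v1) = 0"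
    and v1: "\<And>w. norm w = 1 \<Longrightarrow> v1 \<bullet> w = 0 \<Longrightarrow> u1 \<bullet> (T *v w) = 0"
    using bilinear_form_max[OF subspace_UNIV subspace_UNIV nz nz, of T] by auto
  have nz1: "\<exists>w\<in>{x. a \<bullet> x = 0}. w \<noteq> 0" for a :: "real^3"
    using orthogonal_to_vector_exists[of a] by (auto simp: orthogonal_def)
  obtain u2 v2 where 2: "u1 \<bullet> u2 = 0" "norm u2 = 1" "v1 \<bullet> v2 = 0" "norm v2 = 1"
    and u2: "\<And>w. norm w = 1 \<Longrightarrow> u1 \<bullet> w = 0 \<Longrightarrow> u2 \<bullet> w = 0 \<Longrightarrow> w \<bullet> (T *v v2) = 0"
    and v2: "\<And>w. norm w = 1 \<Longrightarrow> v1 \<bullet> w = 0 \<Longrightarrow> v2 \<bullet> w = 0 \<Longrightarrow> u2 \<bullet> (T *v w) = 0"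
    using bilinear_form_max[OF subspace_hyperplane subspace_hyperplane nz1 nz1, of u1 v1 T]
    unfolding mem_Collect_eq by metis
  define u3 v3 where "u3 = cross3 u1 u2" and "v3 = cross3 v1 v2"
  have 3: "norm u3 = 1" "norm v3 = 1" "u1 \<bullet> u3 = 0" "u2 \<bullet> u3 = 0" "v1 \<bullet> v3 = 0" "v2 \<bullet> v3 = 0"
    using 1 2 by (auto simp: u3_def v3_def norm_cross3_orthonormal dot_cross_self)
  \<comment> \<open>Entries involving the first pair vanish by the first maximisation, the other two
    by the second.\<close>
  have off: "u1 \<bullet> (T *v v2) = 0" "u1 \<bullet> (T *v v3) = 0" "u2 \<bullet> (T *v v1) = 0" "u3 \<bullet> (T *v v1) = 0"
    "u2 \<bullet> (T *v v3) = 0" "u3 \<bullet> (T *v v2) = 0"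
    using u1 v1 u2 v2 2 3 by auto
  define s1 s2 s3 where "s1 = u1 \<bullet> (T *v v1)" and "s2 = u2 \<bullet> (T *v v2)" and "s3 = u3 \<bullet> (T *v v3)"
  have T: "T $ m $ n = s1 * (u1 $ m * v1 $ n) + s2 * (u2 $ m * v2 $ n) + s3 * (u3 $ m * v3 $ n)" for m n
  proof -
    have ax: "axis m 1 = (u1 $ m) *\<^sub>R u1 + (u2 $ m) *\<^sub>R u2 + (u3 $ m) *\<^sub>R u3"
      using cross3_orthonormal_expansion[OF 1(1) 2(2,1), of "axis m 1"] by (simp add: inner_axis' u3_def)
    have ay: "axis n 1 = (v1 $ n) *\<^sub>R v1 + (v2 $ n) *\<^sub>R v2 + (v3 $ n) *\<^sub>R v3"
      using cross3_orthonormal_expansion[OF 1(2) 2(4,3), of "axis n 1"] by (simp add: inner_axis' v3_def)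
    have "T $ m $ n = axis m 1 \<bullet> (T *v axis n 1)"
      by (simp add: inner_axis inner_axis' matrix_vector_mul_component)
    also have "\<dots> = s1 * (u1 $ m * v1 $ n) + s2 * (u2 $ m * v2 $ n) + s3 * (u3 $ m * v3 $ n)"
      unfolding ax ay
      by (simp add: matrix_vector_right_distrib matrix_vector_mult_scaleR inner_add_left inner_add_right off
          algebra_simps flip: s1_def s2_def s3_def)
    finally show ?thesis .
  qed
  show thesis
    by (rule that[OF 1(1) 2(2,1) 1(2) 2(4,3)]) (use T in \<open>unfold u3_def v3_def, blast\<close>)
qed

section \<open>Pauli matrices and Bell states\<close>

text \<open>The contraction of \<open>u\<close> with the three Pauli matrices, which treats rotated
  bases like the standard one.\<close>

definition pauli :: "real^3 \<Rightarrow> complex^2^2" where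
  "pauli u = vector [vector [complex_of_real (u $ 3), Complex (u $ 1) (- (u $ 2))],
                     vector [Complex (u $ 1) (u $ 2), - complex_of_real (u $ 3)]]"

lemma pauli_nth [simp]:
  "pauli u $ 1 $ 1 = complex_of_real (u $ 3)" "pauli u $ 1 $ 2 = Complex (u $ 1) (- (u $ 2))"
  "pauli u $ 2 $ 1 = Complex (u $ 1) (u $ 2)" "pauli u $ 2 $ 2 = - complex_of_real (u $ 3)"
  by (simp_all add: pauli_def)

lemma pauli_mult: "pauli u ** pauli v = (u \<bullet> v) *\<^sub>R mat 1 + mat \<i> ** pauli (cross3 u v)"
  by (simp add: vec_eq_iff forall_2 matrix_mult_nth sum_2 mat_nth inner_vec_def sum_3 cross3_simps
      complex_eq_iff)

lemma cadj_pauli [simp]: "cadj (pauli u) = pauli u"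
  by (simp add: vec_eq_iff forall_2 complex_eq_iff)

lemma ctrace_pauli [simp]: "ctrace (pauli u) = 0"
  by (simp add: ctrace_def sum_2)

lemma pauli_minus: "pauli (- u) = - pauli u"
  by (simp add: vec_eq_iff forall_2 complex_eq_iff)

section \<open>Matrix algebra, traces and positivity tests\<close>

lemma scaleR_matrix_mult_left: "(r *\<^sub>R A) ** B = r *\<^sub>R (A ** B)"
  and scaleR_matrix_mult_right: "A ** (r *\<^sub>R B) = r *\<^sub>R (A ** B)"
  for A :: "complex^'n^'m" and B :: "complex^'k^'n"
  by (simp_all add: vec_eq_iff matrix_mult_nth scaleR_sum_right)

lemma matrix_mult_add_left: "(A + B) ** C = A ** C + B ** C" for A :: "complex^'n^'m"
  by (simp add: vec_eq_iff matrix_mult_nth distrib_right sum.distrib)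

lemmas matrix_algebra_simps = matrix_add_ldistrib matrix_mult_add_left
  scaleR_matrix_mult_left scaleR_matrix_mult_right

lemma ctrace_mult_commute: "ctrace (A ** B) = ctrace (B ** A)"
  unfolding ctrace_def matrix_mult_nth by (subst sum.swap) (simp add: mult.commute)

lemma ctrace_add: "ctrace (A + B) = ctrace A + ctrace B"
  and ctrace_scaleR: "ctrace (r *\<^sub>R A) = r *\<^sub>R ctrace A"
  by (simp_all add: ctrace_def sum.distrib scaleR_sum_right)

lemma ctrace_mat: "ctrace (mat c :: complex^'n^'n) = of_nat CARD('n) * c"
  by (simp add: ctrace_def mat_nth)

text \<open>With Gram factors \<open>S\<close> and \<open>T\<close> the trace is the squared
  Frobenius norm of \<open>S ** cadj T\<close>. Positive operators thus test one another.\<close>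

lemma Re_ctrace_psd_mult_nonneg:
  assumes "psd P" "psd Q"
  shows "Re (ctrace (P ** Q)) \<ge> 0"
proof -
  obtain S T where S: "P = cadj S ** S" and T: "Q = cadj T ** T"
    using assms psd_imp_cadj_mult by metis
  have "ctrace (P ** Q) = ctrace (cadj (S ** cadj T) ** (S ** cadj T))"
    using ctrace_mult_commute[of "cadj S ** S ** cadj T" T]
    by (simp add: S T cadj_mult matrix_mul_assoc)
  also have "Re \<dots> \<ge> 0"
    by (simp add: ctrace_def matrix_mult_nth[of "cadj _"] Re_sum sum_nonneg)
  finally show ?thesis .
qed

text \<open>Self-adjointness turns \<open>r *\<^sub>R A\<close> into the Gram product
  \<open>cadj A ** A\<close>; such an \<open>A\<close> is \<open>r\<close> times an orthogonal
  projection.\<close>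

lemma psd_if_square:
  assumes "cadj A = A" "A ** A = r *\<^sub>R A" "r > 0"
  shows "psd A"
proof -
  have "psd (r *\<^sub>R A)" using psd_cadj_mult[of A] assms by simp
  then have "psd ((1 / r) *\<^sub>R (r *\<^sub>R A))" using assms(3) by (intro psd_scaleR[of "r *\<^sub>R A"]) auto
  then show ?thesis using assms(3) by simp
qed

lemma square_mat_1_add_involution:
  fixes A :: "complex^'n^'n"
  assumes "A ** A = mat 1" "r\<^sup>2 = 1"
  shows "(mat 1 + r *\<^sub>R A) ** (mat 1 + r *\<^sub>R A) = 2 *\<^sub>R (mat 1 + r *\<^sub>R A)"
proof -
  have "r * r = 1" using assms(2) by (simp add: power2_eq_square)
  then have "(mat 1 + r *\<^sub>R A) ** (mat 1 + r *\<^sub>R A) = (mat 1 + r *\<^sub>R A) + (r *\<^sub>R A + mat 1)"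
    by (simp only: matrix_algebra_simps assms(1) matrix_mul_lid matrix_mul_rid
        scaleR_add_right scaleR_scaleR scaleR_one)
  then show ?thesis by (simp only: scaleR_2 add.commute)
qed

text \<open>The source of the minus sign in the Bell test operators: each tensor factor of a Pauli
  product contributes an imaginary unit.\<close>

lemma kron_mat_ii: "kron (mat \<i> ** X) (mat \<i> ** Y) = - kron X Y"
  by (simp add: vec_eq_iff kron_nth mat_mult_nth complex_eq_iff algebra_simps)

lemma kron_pauli_mult_orthogonal:
  assumes "u \<bullet> u' = 0" "v \<bullet> v' = 0"
  shows "kron (pauli u) (pauli v) ** kron (pauli u') (pauli v')
    = - kron (pauli (cross3 u u')) (pauli (cross3 v v'))"
  by (simp add: kron_mult pauli_mult assms kron_mat_ii)

lemma pauli_square: "norm u = 1 \<Longrightarrow> pauli u ** pauli u = mat 1"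
  by (simp add: pauli_mult norm_eq_1) (simp add: vec_eq_iff forall_2 matrix_mult_nth sum_2 complex_eq_iff)

lemma kron_pauli_square:
  "norm u = 1 \<Longrightarrow> norm v = 1 \<Longrightarrow>
    kron (pauli u) (pauli v) ** kron (pauli u) (pauli v) = mat 1"
  by (simp add: kron_mult pauli_square kron_mat_mat)

lemma ctrace_kron_pauli_mult:
  "ctrace (kron (pauli u) (pauli v) ** kron (pauli u') (pauli v'))
    = complex_of_real (4 * (u \<bullet> u') * (v \<bullet> v'))"
proof -
  have "ctrace (pauli a ** pauli b) = complex_of_real (2 * (a \<bullet> b))" for a b
    by (simp add: ctrace_def matrix_mult_nth sum_2 complex_eq_iff inner_vec_def sum_3 algebra_simps)
  then show ?thesis by (simp add: kron_mult ctrace_kron)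
qed

lemma ctrace_kron_pauli [simp]: "ctrace (kron (pauli u) (pauli v)) = 0"
  by (simp add: ctrace_kron)

text \<open>For signs \<open>e1\<close>, \<open>e2\<close> the test operator below is four times the projection onto a Bell state.\<close>

lemma psd_bell:
  assumes u: "norm u1 = 1" "norm u2 = 1" "u1 \<bullet> u2 = 0"
    and v: "norm v1 = 1" "norm v2 = 1" "v1 \<bullet> v2 = 0"
    and e: "e1\<^sup>2 = 1" "e2\<^sup>2 = 1"
  shows "psd (mat 1 + e1 *\<^sub>R kron (pauli u1) (pauli v1) + e2 *\<^sub>R kron (pauli u2) (pauli v2)
    + (- (e1 * e2)) *\<^sub>R kron (pauli (cross3 u1 u2)) (pauli (cross3 v1 v2)))" (is "psd ?Q")
proof (rule psd_if_square)
  let ?A1 = "kron (pauli u1) (pauli v1)" and ?A2 = "kron (pauli u2) (pauli v2)"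
  let ?A3 = "kron (pauli (cross3 u1 u2)) (pauli (cross3 v1 v2))"
  have 12: "?A1 ** ?A2 = - ?A3" using u v by (simp add: kron_pauli_mult_orthogonal)
  \<comment> \<open>Reversing the order flips both cross products and the two signs cancel, so the
    operators commute.\<close>
  have 21: "?A2 ** ?A1 = - ?A3"
    using kron_pauli_mult_orthogonal[of u2 u1 v2 v1] u v
    by (simp add: inner_commute cross_skew[of u2 u1] cross_skew[of v2 v1] pauli_minus)
       (simp add: vec_eq_iff kron_nth)
  \<comment> \<open>The test operator factors into commuting \<open>B\<close> and \<open>C\<close>,
    each squaring to twice itself; its third term comes from \<open>?A1 ** ?A2\<close>.\<close>
  define B where "B = mat 1 + e1 *\<^sub>R ?A1"
  define C where "C = mat 1 + e2 *\<^sub>R ?A2"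
  have Q: "?Q = B ** C"
    by (simp add: B_def C_def matrix_algebra_simps 12 algebra_simps)
  have comm: "B ** C = C ** B"
    by (simp add: B_def C_def matrix_algebra_simps 12 21 algebra_simps)
  have BB: "B ** B = 2 *\<^sub>R B" and CC: "C ** C = 2 *\<^sub>R C"
    unfolding B_def C_def using u v e by (simp_all add: square_mat_1_add_involution kron_pauli_square)
  have "(B ** C) ** (B ** C) = B ** (C ** B) ** C" by (simp only: matrix_mul_assoc)
  also have "\<dots> = (B ** B) ** (C ** C)" by (simp only: comm[symmetric] matrix_mul_assoc)
  finally have "(B ** C) ** (B ** C) = (B ** B) ** (C ** C)" .
  then show "?Q ** ?Q = 4 *\<^sub>R ?Q"
    unfolding Q BB CC by (simp add: matrix_algebra_simps)
  show "cadj ?Q = ?Q" by (simp add: cadj_add cadj_diff cadj_scaleR cadj_kron)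
qed simp

text \<open>The pure state at the point \<open>u\<close> of the Bloch sphere;
  \<open>mat 1 + pauli u\<close> squares to twice itself.\<close>

lemma density_bloch:
  assumes "norm u = 1"
  shows "density ((1/2) *\<^sub>R (mat 1 + pauli u))"
proof -
  have "psd (mat 1 + pauli u)"
    by (rule psd_if_square[of _ 2])
       (simp_all add: cadj_add matrix_algebra_simps pauli_square assms scaleR_2 add_ac)
  then show ?thesis
    by (simp add: density_def psd_scaleR ctrace_scaleR ctrace_add ctrace_mat complex_eq_iff)
qed

text \<open>Averaging the product states at \<open>(u, v)\<close> and \<open>(- u, - v)\<close>
  cancels the terms with a single Pauli factor and keeps the correlation term.\<close>

lemma bloch_pair_in_hull:
  assumes "norm u = 1" "norm v = 1"
  shows "(1/4) *\<^sub>R (mat 1 + kron (pauli u) (pauli v)) \<in> convex hull product_states"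
proof -
  define P where "P w = (1/2) *\<^sub>R (mat 1 + pauli w)" for w
  have "kron (P w) (P w') \<in> convex hull product_states" if "norm w = 1" "norm w' = 1" for w w'
    using density_bloch that by (auto simp: product_states_def P_def intro!: hull_inc)
  then have "(1/2) *\<^sub>R kron (P u) (P v) + (1/2) *\<^sub>R kron (P (- u)) (P (- v)) \<in> convex hull product_states"
    using assms by (intro convexD[OF convex_convex_hull]) auto
  also have "(1/2) *\<^sub>R kron (P u) (P v) + (1/2) *\<^sub>R kron (P (- u)) (P (- v))
      = (1/4) *\<^sub>R (mat 1 + kron (pauli u) (pauli v))"
    by (simp add: P_def pauli_minus vec_eq_iff kron_nth mat_nth)
       (auto simp: scaleR_conv_of_real[where 'a = complex] field_simps)
  finally show ?thesis .
qed

text \<open>The coefficients range over an octahedron whose vertices are the signed pair states. A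
  vertex gets the absolute value of its coefficient as weight, and the remaining weight goes to the
  maximally mixed state at the centre.\<close>

lemma cross_polytope_in_hull:
  assumes "norm u1 = 1" "norm u2 = 1" "norm u3 = 1" "norm v1 = 1" "norm v2 = 1" "norm v3 = 1"
    and s: "\<bar>s1\<bar> + \<bar>s2\<bar> + \<bar>s3\<bar> \<le> 1"
  shows "(1/4) *\<^sub>R (mat 1 + s1 *\<^sub>R kron (pauli u1) (pauli v1) + s2 *\<^sub>R kron (pauli u2) (pauli v2)
    + s3 *\<^sub>R kron (pauli u3) (pauli v3)) \<in> convex hull product_states"
proof -
  let ?H = "convex hull product_states :: (complex^(2\<times>2)^(2\<times>2)) set"
  \<comment> \<open>Since \<open>sgn 0 = 0\<close>, a vanishing coefficient selects the maximally
    mixed state.\<close>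
  define E where "E s u v = (1/4) *\<^sub>R (mat 1 + sgn s *\<^sub>R kron (pauli u) (pauli v))" for s :: real and u v
  have pm: "(1/4) *\<^sub>R (mat 1 + kron (pauli u) (pauli v)) \<in> ?H"
    "(1/4) *\<^sub>R (mat 1 - kron (pauli u) (pauli v)) \<in> ?H" if "norm u = 1" "norm v = 1" for u v
  proof -
    \<comment> \<open>A negative sign is absorbed into the second Bloch vector.\<close>
    have "kron (pauli u) (pauli (- v)) = - kron (pauli u) (pauli v)"
      by (simp add: pauli_minus vec_eq_iff kron_nth)
    then show "(1/4) *\<^sub>R (mat 1 - kron (pauli u) (pauli v)) \<in> ?H"
      using bloch_pair_in_hull[of u "- v"] that by simp
  qed (use bloch_pair_in_hull that in blast)
  have mid: "(1/4) *\<^sub>R mat 1 \<in> ?H"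
  proof -
    have "(1/4) *\<^sub>R mat 1 = (1/2) *\<^sub>R ((1/4) *\<^sub>R (mat 1 + kron (pauli u1) (pauli v1)))
        + (1/2) *\<^sub>R ((1/4) *\<^sub>R (mat 1 - kron (pauli u1) (pauli v1)))"
      by (simp add: scaleR_add_right scaleR_diff_right flip: scaleR_add_left)
    also have "\<dots> \<in> ?H"
      using pm assms by (intro convexD[OF convex_convex_hull]) auto
    finally show ?thesis .
  qed
  have E: "E s u v \<in> ?H" if "norm u = 1" "norm v = 1" for s u v
    using pm[OF that] mid by (cases s "0::real" rule: linorder_cases) (simp_all add: E_def)
  define w where "w = (!) [\<bar>s1\<bar>, \<bar>s2\<bar>, \<bar>s3\<bar>, 1 - \<bar>s1\<bar> - \<bar>s2\<bar> - \<bar>s3\<bar>]"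
  define x where "x = (!) [E s1 u1 v1, E s2 u2 v2, E s3 u3 v3, (1/4) *\<^sub>R mat 1]"
  have "(\<Sum>i<4. w i *\<^sub>R x i) \<in> ?H"
    by (intro convex_sum)
       (use s E assms mid in \<open>auto simp: w_def x_def eval_nat_numeral less_Suc_eq\<close>)
  also have "(\<Sum>i<4. w i *\<^sub>R x i) = (1/4) *\<^sub>R (mat 1 + s1 *\<^sub>R kron (pauli u1) (pauli v1)
      + s2 *\<^sub>R kron (pauli u2) (pauli v2) + s3 *\<^sub>R kron (pauli u3) (pauli v3))"
  proof -
    have "\<bar>s\<bar> *\<^sub>R E s u v = (\<bar>s\<bar> / 4) *\<^sub>R mat 1 + (s / 4) *\<^sub>R kron (pauli u) (pauli v)" for s u v
      by (simp add: E_def scaleR_add_right abs_mult_sgn)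
    then show ?thesis
      by (simp add: w_def x_def eval_nat_numeral)
         (simp add: vec_eq_iff scaleR_conv_of_real[where 'a = complex] field_simps)
  qed
  finally show ?thesis .
qed

text \<open>Hermiticity and the two marginals leave only the nine real correlations free; a singular
  value decomposition of their matrix brings the correlation part to diagonal form.\<close>

lemma locally_maximally_mixed_normal_form:
  fixes rho :: "complex^(2\<times>2)^(2\<times>2)"
  assumes herm: "hermitian rho" and B: "ptrace_B rho = mat (1/2)" and A: "ptrace_A rho = mat (1/2)"
  obtains u1 u2 v1 v2 s1 s2 s3
  where "norm u1 = 1" "norm u2 = 1" "u1 \<bullet> u2 = 0" "norm v1 = 1" "norm v2 = 1" "v1 \<bullet> v2 = 0"
    "rho = (1/4) *\<^sub>R (mat 1 + s1 *\<^sub>R kron (pauli u1) (pauli v1) + s2 *\<^sub>R kron (pauli u2) (pauli v2)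
      + s3 *\<^sub>R kron (pauli (cross3 u1 u2)) (pauli (cross3 v1 v2)))"
proof -
  define a b c d where "a = rho $ (1,1) $ (2,2)" and "b = rho $ (1,2) $ (2,1)"
    and "c = rho $ (1,1) $ (1,2)" and "d = rho $ (1,1) $ (2,1)"
  \<comment> \<open>Entry \<open>(m, n)\<close> is the trace of \<open>rho\<close> against the
    tensor product of the \<open>m\<close>-th and \<open>n\<close>-th Pauli matrices, reduced to
    five entries of \<open>rho\<close> by the marginals and Hermiticity.\<close>
  define T :: "real^3^3" where "T = vector [
    vector [2 * Re (a + b), 2 * Im (b - a), 4 * Re d],
    vector [- 2 * Im (a + b), 2 * Re (b - a), - 4 * Im d],
    vector [4 * Re c, - 4 * Im c, 4 * Re (rho $ (1,1) $ (1,1)) - 1]]"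
  obtain u1 u2 v1 v2 s1 s2 s3
    where on: "norm u1 = 1" "norm u2 = 1" "u1 \<bullet> u2 = 0" "norm v1 = 1" "norm v2 = 1" "v1 \<bullet> v2 = 0"
      and T: "\<forall>m n. T $ m $ n = s1 * (u1 $ m * v1 $ n) + s2 * (u2 $ m * v2 $ n)
        + s3 * (cross3 u1 u2 $ m * cross3 v1 v2 $ n)"
    by (rule real3_svd[of T])
  define u3 v3 where "u3 = cross3 u1 u2" and "v3 = cross3 v1 v2"
  note T' = T[rule_format, folded u3_def v3_def]
  have T_entries:
    "2 * Re (a + b) = s1 * (u1 $ 1 * v1 $ 1) + s2 * (u2 $ 1 * v2 $ 1) + s3 * (u3 $ 1 * v3 $ 1)"
    "2 * Im (b - a) = s1 * (u1 $ 1 * v1 $ 2) + s2 * (u2 $ 1 * v2 $ 2) + s3 * (u3 $ 1 * v3 $ 2)"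
    "4 * Re d = s1 * (u1 $ 1 * v1 $ 3) + s2 * (u2 $ 1 * v2 $ 3) + s3 * (u3 $ 1 * v3 $ 3)"
    "- 2 * Im (a + b) = s1 * (u1 $ 2 * v1 $ 1) + s2 * (u2 $ 2 * v2 $ 1) + s3 * (u3 $ 2 * v3 $ 1)"
    "2 * Re (b - a) = s1 * (u1 $ 2 * v1 $ 2) + s2 * (u2 $ 2 * v2 $ 2) + s3 * (u3 $ 2 * v3 $ 2)"
    "- 4 * Im d = s1 * (u1 $ 2 * v1 $ 3) + s2 * (u2 $ 2 * v2 $ 3) + s3 * (u3 $ 2 * v3 $ 3)"
    "4 * Re c = s1 * (u1 $ 3 * v1 $ 1) + s2 * (u2 $ 3 * v2 $ 1) + s3 * (u3 $ 3 * v3 $ 1)"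
    "- 4 * Im c = s1 * (u1 $ 3 * v1 $ 2) + s2 * (u2 $ 3 * v2 $ 2) + s3 * (u3 $ 3 * v3 $ 2)"
    "4 * Re (rho $ (1,1) $ (1,1)) - 1 = s1 * (u1 $ 3 * v1 $ 3) + s2 * (u2 $ 3 * v2 $ 3) + s3 * (u3 $ 3 * v3 $ 3)"
    using T'[of 1 1] T'[of 1 2] T'[of 1 3] T'[of 2 1] T'[of 2 2] T'[of 2 3] T'[of 3 1] T'[of 3 2] T'[of 3 3]
    unfolding T_def vector_3 by blast+
  have cnj: "rho $ p $ q = cnj (rho $ q $ p)" for p q
    using herm by (metis cadj_nth hermitian_def)
  have real: "Im (rho $ p $ p) = 0" for p
    using cnj[of p p] by (simp add: complex_eq_iff)
  have marg_B: "rho $ (i,1) $ (k,1) + rho $ (i,2) $ (k,2) = (if i = k then 1/2 else 0)" for i k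
    using B by (simp add: vec_eq_iff ptrace_B_def mat_nth sum_2)
  have marg_A: "rho $ (1,j) $ (1,l) + rho $ (2,j) $ (2,l) = (if j = l then 1/2 else 0)" for j l
    using A by (simp add: vec_eq_iff ptrace_A_def mat_nth sum_2)
  have r: "rho $ (1,2) $ (2,2) = - d" "rho $ (2,1) $ (2,2) = - c"
    "rho $ (2,1) $ (1,1) = cnj d" "rho $ (1,2) $ (1,1) = cnj c"
    "rho $ (2,2) $ (1,1) = cnj a" "rho $ (2,1) $ (1,2) = cnj b"
    "rho $ (2,2) $ (1,2) = - cnj d" "rho $ (2,2) $ (2,1) = - cnj c"
    "rho $ (1,2) $ (1,2) = 1/2 - rho $ (1,1) $ (1,1)" "rho $ (2,1) $ (2,1) = 1/2 - rho $ (1,1) $ (1,1)"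
    "rho $ (2,2) $ (2,2) = rho $ (1,1) $ (1,1)"
  proof -
    show *: "rho $ (1,2) $ (2,2) = - d" "rho $ (2,1) $ (2,2) = - c"
      using marg_B[of 1 2] marg_A[of 1 2] by (simp_all add: c_def d_def add_eq_0_iff)
    show "rho $ (2,2) $ (1,2) = - cnj d" "rho $ (2,2) $ (2,1) = - cnj c"
      using * cnj by (metis complex_cnj_minus)+
    show "rho $ (2,1) $ (1,1) = cnj d" "rho $ (1,2) $ (1,1) = cnj c"
      "rho $ (2,2) $ (1,1) = cnj a" "rho $ (2,1) $ (1,2) = cnj b"
      unfolding a_def b_def c_def d_def by (rule cnj)+
    show **: "rho $ (1,2) $ (1,2) = 1/2 - rho $ (1,1) $ (1,1)" "rho $ (2,1) $ (2,1) = 1/2 - rho $ (1,1) $ (1,1)"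
      using marg_A[of 1 1] marg_B[of 1 1] by (simp_all add: eq_diff_eq add.commute)
    show "rho $ (2,2) $ (2,2) = rho $ (1,1) $ (1,1)"
      using marg_A[of 2 2] unfolding ** by (simp add: algebra_simps)
  qed
  \<comment> \<open>All sixteen entries are compared by real and imaginary parts; each comparison is
    linear in the nine equations of \<open>T_entries\<close>.\<close>
  have "rho = (1/4) *\<^sub>R (mat 1 + s1 *\<^sub>R kron (pauli u1) (pauli v1) + s2 *\<^sub>R kron (pauli u2) (pauli v2)
      + s3 *\<^sub>R kron (pauli u3) (pauli v3))"
    unfolding vec_eq_iff split_paired_All forall_2 kron_nth vector_add_component vector_scaleR_component
      mat_nth fst_conv snd_conv pauli_nth r a_def[symmetric] b_def[symmetric] c_def[symmetric] d_def[symmetric]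
      complex_eq_iff
    using T_entries real[of "(1,1)"] by (intro conjI; simp; argo)
  then show thesis using that on by (simp add: u3_def v3_def)
qed

section \<open>The amplitude bound and separability for two qubits\<close>

theorem theorem5:
  fixes rho :: "complex^(2\<times>2)^(2\<times>2)"
  assumes "density rho"
    and "ptrace_B rho = mat (1/2)"
    and "ptrace_A rho = mat (1/2)"
  shows "psd (mat 1 - cond_amp rho) \<longleftrightarrow> separable rho"
proof -
  have psd: "psd rho" using assms(1) by (simp add: density_def)
  have marg: "ptrace_A rho = mat (complex_of_real (1/2))" using assms(3) by simp
  have amp: "cond_amp rho = 2 *\<^sub>R rho"
    using cond_amp_maximally_mixed_marginal[OF psd _ marg] by simp
  show ?thesis unfolding amp
  proof
    assume "separable rho"
    then have "psd (kron (mat 1) (ptrace_A rho) - rho)" by (rule separable_imp_reduction)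
    moreover have "kron (mat 1 :: complex^2^2) (ptrace_A rho) = (1/2) *\<^sub>R mat 1"
      unfolding marg kron_mat_mat mult_1_left by (rule mat_eq_scaleR)
    ultimately have "psd (2 *\<^sub>R ((1/2) *\<^sub>R mat 1 - rho))"
      by (intro psd_scaleR) simp_all
    then show "psd (mat 1 - 2 *\<^sub>R rho)" by (simp add: scaleR_diff_right)
  next
    assume psd': "psd (mat 1 - 2 *\<^sub>R rho)"
    obtain u1 u2 v1 v2 s1 s2 s3
      where on: "norm u1 = 1" "norm u2 = 1" "u1 \<bullet> u2 = 0" "norm v1 = 1" "norm v2 = 1" "v1 \<bullet> v2 = 0"
        and rho: "rho = (1/4) *\<^sub>R (mat 1 + s1 *\<^sub>R kron (pauli u1) (pauli v1) + s2 *\<^sub>R kron (pauli u2) (pauli v2)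
          + s3 *\<^sub>R kron (pauli (cross3 u1 u2)) (pauli (cross3 v1 v2)))"
      by (rule locally_maximally_mixed_normal_form[OF _ assms(2,3)]) (use psd in \<open>simp add: psd_def\<close>)
    define A1 A2 A3 where "A1 = kron (pauli u1) (pauli v1)" and "A2 = kron (pauli u2) (pauli v2)"
      and "A3 = kron (pauli (cross3 u1 u2)) (pauli (cross3 v1 v2))"
    have rho': "rho = (1/4) *\<^sub>R (mat 1 + s1 *\<^sub>R A1 + s2 *\<^sub>R A2 + s3 *\<^sub>R A3)"
      unfolding A1_def A2_def A3_def by (rule rho)
    have u3: "norm (cross3 u1 u2) = 1" "norm (cross3 v1 v2) = 1"
      using on by (auto intro: norm_cross3_orthonormal)
    have tr: "ctrace A1 = 0" "ctrace A2 = 0" "ctrace A3 = 0"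
      "ctrace (A1 ** A1) = 4" "ctrace (A2 ** A2) = 4" "ctrace (A3 ** A3) = 4"
      "ctrace (A1 ** A2) = 0" "ctrace (A2 ** A1) = 0" "ctrace (A1 ** A3) = 0"
      "ctrace (A3 ** A1) = 0" "ctrace (A2 ** A3) = 0" "ctrace (A3 ** A2) = 0"
      using on u3 by (simp_all add: A1_def A2_def A3_def ctrace_kron_pauli_mult norm_eq_1
          dot_cross_self inner_commute)
    \<comment> \<open>The case \<open>\<delta> = 1\<close> is \<open>4 *\<^sub>R rho\<close>; the
      case \<open>\<delta> = -1\<close> is twice \<open>mat 1 - 2 *\<^sub>R rho\<close>, which
      reverses all correlations.\<close>
    have psd_pm: "psd (mat 1 + (\<delta> * s1) *\<^sub>R A1 + (\<delta> * s2) *\<^sub>R A2 + (\<delta> * s3) *\<^sub>R A3)"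
      if "\<delta> \<in> {1, -1}" for \<delta>
    proof (cases "\<delta> = 1")
      case True
      then show ?thesis using psd_scaleR[OF psd, of 4] by (simp add: rho')
    next
      case False
      then show ?thesis using psd_scaleR[OF psd', of 2] that
        by (simp add: rho' scaleR_2 algebra_simps)
    qed
    \<comment> \<open>A quarter of the trace of this operator against a Bell test operator.\<close>
    have ineq: "1 + \<delta> * (e1 * s1 + e2 * s2 - e1 * e2 * s3) \<ge> 0"
      if "\<delta> \<in> {1, -1}" "e1 \<in> {1, -1}" "e2 \<in> {1, -1}" for \<delta> e1 e2 :: real
    proof -
      have "psd (mat 1 + e1 *\<^sub>R A1 + e2 *\<^sub>R A2 + (- (e1 * e2)) *\<^sub>R A3)"
        unfolding A1_def A2_def A3_def using on that by (intro psd_bell) auto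
      from Re_ctrace_psd_mult_nonneg[OF this psd_pm[OF that(1)]] show ?thesis
        by (simp add: matrix_algebra_simps ctrace_add ctrace_scaleR tr ctrace_mat del: scaleR_minus_left)
          (simp add: algebra_simps)
    qed
    \<comment> \<open>The triples \<open>(e1, e2, - (e1 * e2))\<close> are the four sign patterns
      with product -1, and \<open>\<delta> = -1\<close> supplies the other four. Geometrically, a
      tetrahedron and its mirror image meet in the octahedron.\<close>
    have "\<bar>s1\<bar> + \<bar>s2\<bar> + \<bar>s3\<bar> \<le> 1"
      using ineq[of 1 1 1] ineq[of 1 1 "-1"] ineq[of 1 "-1" 1] ineq[of 1 "-1" "-1"]
        ineq[of "-1" 1 1] ineq[of "-1" 1 "-1"] ineq[of "-1" "-1" 1] ineq[of "-1" "-1" "-1"]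
      by (simp add: abs_if)
    then show "separable rho"
      unfolding separable_iff_convex_hull rho
      using on u3 by (intro cross_polytope_in_hull)
  qed
qed

end
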